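(* For any set $X$, there is a 1-1 correspondence between equivalence classes of covering posets over $X$ and reduced cocycles $c:X^3\to\mathbb N$. (The correspondence sends a covering poset to its structure cocycle.)
   Context: $\mathbb N=\{0,1,2,\dots\}$. A poset is a set with a reflexive transitive relation $\le$ (not necessarily antisymmetric); $x\approx y$ means $x\le y$ and $y\le x$; $x<y$ means $x\le y$ and $x\not\approx y$. A covering poset of a set $X$ is a poset $\tilde X$ together with a surjective mapping $\pi:\tilde X\to X$ such that: (1) for each $x\in X$, $\pi^{-1}(x)\subseteq\tilde X$ is isomorphic as a poset to the set of integers with the usual ordering; (2) there exists an automorphism $\sigma$ of the poset $\tilde X$ such that, for any $\tilde x\in\tilde X$, $\sigma\tilde x$ is the smallest element of $\pi^{-1}(\pi(\tilde x))$ which is greater than $\tilde x$ (so $\sigma$ is uniquely determined); (3) for every pair $\tilde x,\tilde y\in\tilde X$ there is an integer $m\ge0$ with $\tilde x\le\sigma^m\tilde y\le\sigma^{2m}\tilde x$. An equivalence of covering posets $f:\tilde X\to\tilde X'$ is a $\sigma$-equivariant poset isomorphism over $X$: $\pi'f=\pi$ and $\sigma f=f\sigma$. A cocycle on $X$ is a function $c:X^3\to\mathbb N$ with $c(xyz)-c(wyz)+c(wxz)-c(wxy)=0$ for all $w,x,y,z\in X$; it is reduced if $c(xxy)=c(xyy)=0$ for all $x,y\in X$. Structure cocycle: given a covering poset $\pi:\tilde X\to X$ and a section $\lambda:X\to\tilde X$ of $\pi$, let $b_\lambda(xy)$ be the smallest integer $m$ with $\lambda(x)\le\sigma^m\lambda(y)$.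 The structure cocycle of $\tilde X$ is $c(xyz)=b_\lambda(yz)-b_\lambda(xz)+b_\lambda(xy)$, a reduced cocycle with values in $\mathbb N$ that does not depend on $\lambda$. *)

theory Defs
  imports "HOL-Library.FuncSet" "HOL-Library.Equipollence"
begin

text \<open>
  Posets are reflexive and transitive but not necessarily antisymmetric, hence the use of
  \<^const>\<open>preorder_on\<close>; \<open>strictly_below\<close> is the relation
  \<open>x < y\<close>, meaning \<open>x \<le> y\<close> and not \<open>x \<approx> y\<close>.
\<close>

definition strictly_below :: "'b rel \<Rightarrow> 'b \<Rightarrow> 'b \<Rightarrow> bool" where
  "strictly_below r x y \<longleftrightarrow> (x, y) \<in> r \<and> (y, x) \<notin> r"

definition poset_iso :: "'b set \<Rightarrow> 'b rel \<Rightarrow> 'c set \<Rightarrow> 'c rel \<Rightarrow> ('b \<Rightarrow> 'c) \<Rightarrow> bool" where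
  "poset_iso A r B s f \<longleftrightarrow>
     bij_betw f A B \<and> (\<forall>x\<in>A. \<forall>y\<in>A. (x, y) \<in> r \<longleftrightarrow> (f x, f y) \<in> s)"

record ('b, 'a) poset_over =
  points :: "'b set"
  leq :: "'b rel"
  proj :: "'b \<Rightarrow> 'a"

definition fiber :: "('b, 'a) poset_over \<Rightarrow> 'a \<Rightarrow> 'b set" where
  "fiber P x = {u \<in> points P. proj P u = x}"

definition shift_automorphism :: "('b, 'a) poset_over \<Rightarrow> ('b \<Rightarrow> 'b) \<Rightarrow> bool" where
  "shift_automorphism P \<sigma> \<longleftrightarrow>
     poset_iso (points P) (leq P) (points P) (leq P) \<sigma> \<and>
     (\<forall>u\<in>points P.
        \<sigma> u \<in> fiber P (proj P u) \<and> strictly_below (leq P) u (\<sigma> u) \<and>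
        (\<forall>v\<in>fiber P (proj P u). strictly_below (leq P) u v \<longrightarrow> (\<sigma> u, v) \<in> leq P))"

text \<open>
  The shift is determined only on the points of \<open>P\<close>; extensionality makes it
  unique as a function.
\<close>

definition shift :: "('b, 'a) poset_over \<Rightarrow> 'b \<Rightarrow> 'b" where
  "shift P = (THE \<sigma>. \<sigma> \<in> extensional (points P) \<and> shift_automorphism P \<sigma>)"

definition shift_power :: "('b, 'a) poset_over \<Rightarrow> int \<Rightarrow> 'b \<Rightarrow> 'b" where
  "shift_power P m =
     (if 0 \<le> m then shift P ^^ nat m else inv_into (points P) (shift P) ^^ nat (- m))"

definition covering_poset :: "'a set \<Rightarrow> ('b, 'a) poset_over \<Rightarrow> bool" where
  "covering_poset X P \<longleftrightarrow>
     preorder_on (points P) (leq P) \<and>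
     proj P ` points P = X \<and>
     (\<forall>x\<in>X. \<exists>f. poset_iso (fiber P x) (leq P) (UNIV :: int set) {(i, j). i \<le> j} f) \<and>
     (\<exists>\<sigma>. shift_automorphism P \<sigma>) \<and>
     (\<forall>u\<in>points P. \<forall>v\<in>points P. \<exists>m\<ge>0.
        (u, shift_power P m v) \<in> leq P \<and> (shift_power P m v, shift_power P (2 * m) u) \<in> leq P)"

definition covering_equivalence ::
    "('b, 'a) poset_over \<Rightarrow> ('c, 'a) poset_over \<Rightarrow> ('b \<Rightarrow> 'c) \<Rightarrow> bool" where
  "covering_equivalence P Q f \<longleftrightarrow>
     poset_iso (points P) (leq P) (points Q) (leq Q) f \<and>
     (\<forall>u\<in>points P. proj Q (f u) = proj P u) \<and>
     (\<forall>u\<in>points P. f (shift P u) = shift Q (f u))"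

text \<open>
  The points live in a fixed type \<open>'b\<close>. A covering poset of \<open>X\<close> is in bijection with
  \<open>X \<times> \<int>\<close>, so up to equivalence all covering posets of \<open>X\<close> occur
  as soon as \<open>'b\<close> has room for \<open>X \<times> \<int>\<close>.
\<close>

definition covering_posets :: "'a set \<Rightarrow> ('b, 'a) poset_over set" where
  "covering_posets X = {P. covering_poset X P}"

definition covering_equiv :: "'a set \<Rightarrow> ('b, 'a) poset_over rel" where
  "covering_equiv X =
     {(P, Q). P \<in> covering_posets X \<and> Q \<in> covering_posets X \<and> (\<exists>f. covering_equivalence P Q f)}"

definition cocycle :: "'a set \<Rightarrow> ('a \<times> 'a \<times> 'a \<Rightarrow> nat) \<Rightarrow> bool" where
  "cocycle X c \<longleftrightarrow>
     (\<forall>w\<in>X. \<forall>x\<in>X. \<forall>y\<in>X. \<forall>z\<in>X.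
        int (c (x, y, z)) - int (c (w, y, z)) + int (c (w, x, z)) - int (c (w, x, y)) = 0)"

definition reduced_cocycles :: "'a set \<Rightarrow> ('a \<times> 'a \<times> 'a \<Rightarrow> nat) set" where
  "reduced_cocycles X =
     {c \<in> X \<times> X \<times> X \<rightarrow>\<^sub>E UNIV.
        cocycle X c \<and> (\<forall>x\<in>X. \<forall>y\<in>X. c (x, x, y) = 0 \<and> c (x, y, y) = 0)}"

definition is_section :: "'a set \<Rightarrow> ('b, 'a) poset_over \<Rightarrow> ('a \<Rightarrow> 'b) \<Rightarrow> bool" where
  "is_section X P s \<longleftrightarrow> (\<forall>x\<in>X. s x \<in> points P \<and> proj P (s x) = x)"

definition section_offset :: "('b, 'a) poset_over \<Rightarrow> ('a \<Rightarrow> 'b) \<Rightarrow> 'a \<Rightarrow> 'a \<Rightarrow> int" where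
  "section_offset P s x y = (LEAST m. (s x, shift_power P m (s y)) \<in> leq P)"

text \<open>
  \<open>c\<close> is given by the same formula for every section: the structure cocycle does
  not depend on a choice. Sections exist since \<^const>\<open>proj\<close> is surjective.
\<close>

definition is_structure_cocycle ::
    "'a set \<Rightarrow> ('b, 'a) poset_over \<Rightarrow> ('a \<times> 'a \<times> 'a \<Rightarrow> nat) \<Rightarrow> bool" where
  "is_structure_cocycle X P c \<longleftrightarrow>
     c \<in> X \<times> X \<times> X \<rightarrow>\<^sub>E UNIV \<and>
     (\<forall>s. is_section X P s \<longrightarrow>
        (\<forall>x\<in>X. \<forall>y\<in>X. \<forall>z\<in>X.
           int (c (x, y, z)) =
             section_offset P s y z - section_offset P s x z + section_offset P s x y))"

lemma shift_automorphism_unique: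
  assumes "covering_poset X P" "shift_automorphism P \<sigma>" "shift_automorphism P \<tau>" "u \<in> points P"
  shows "\<sigma> u = \<tau> u"
proof -
  let ?F = "fiber P (proj P u)"
  have "proj P u \<in> X" using assms by (auto simp: covering_poset_def)
  then obtain f where f: "poset_iso ?F (leq P) (UNIV :: int set) {(i, j). i \<le> j} f"
    using assms(1) unfolding covering_poset_def by blast
  have 1: "\<sigma> u \<in> ?F" "\<tau> u \<in> ?F" "(\<sigma> u, \<tau> u) \<in> leq P" "(\<tau> u, \<sigma> u) \<in> leq P"
    using assms(2-4) by (auto simp: shift_automorphism_def)
  then have "f (\<sigma> u) = f (\<tau> u)" using f by (force simp: poset_iso_def)
  then show ?thesis using f 1 by (auto simp: poset_iso_def bij_betw_def inj_on_def)
qed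

lemma shift_automorphism_shift:
  assumes "covering_poset X P"
  shows "shift_automorphism P (shift P)"
proof -
  obtain \<sigma> where \<sigma>: "shift_automorphism P \<sigma>" using assms by (auto simp: covering_poset_def)
  let ?S = "restrict \<sigma> (points P)"
  have mem: "\<sigma> u \<in> points P" if "u \<in> points P" for u
    using \<sigma> that by (auto simp: shift_automorphism_def fiber_def)
  have "bij_betw ?S (points P) (points P) = bij_betw \<sigma> (points P) (points P)"
    by (rule bij_betw_cong) auto
  then have S: "shift_automorphism P ?S"
    using \<sigma> by (auto simp: shift_automorphism_def poset_iso_def)
  have "shift P = ?S"
    unfolding shift_def
  proof (rule the_equality)
    show "?S \<in> extensional (points P) \<and> shift_automorphism P ?S" using S by auto
    fix \<tau> assume \<tau>: "\<tau> \<in> extensional (points P) \<and> shift_automorphism P \<tau>"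
    show "\<tau> = ?S"
      using \<tau> shift_automorphism_unique[OF assms _ S]
      by (intro extensionalityI[of _ "points P"]) blast+
  qed
  with S show ?thesis by simp
qed

lemma shift_points:
  assumes "covering_poset X P" "u \<in> points P"
  shows "shift P u \<in> points P"
  using shift_automorphism_shift[OF assms(1)] assms(2)
  by (auto simp: shift_automorphism_def fiber_def)

lemma covering_equivalence_sym:
  assumes "covering_poset X P" "covering_equivalence P Q f"
  shows "covering_equivalence Q P (inv_into (points P) f)"
proof -
  let ?g = "inv_into (points P) f"
  have bij: "bij_betw f (points P) (points Q)"
    using assms(2) by (auto simp: covering_equivalence_def poset_iso_def)
  then have bij': "bij_betw ?g (points Q) (points P)" by (rule bij_betw_inv_into)
  have fg: "f (?g v) = v" if "v \<in> points Q" for v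
    using bij_betw_inv_into_right[OF bij that] .
  have g: "?g v \<in> points P" if "v \<in> points Q" for v
    using bij_betwE[OF bij'] that by blast
  have gf: "?g (f u) = u" if "u \<in> points P" for u
    using bij_betw_inv_into_left[OF bij that] .
  have "?g (shift Q v) = shift P (?g v)" if v: "v \<in> points Q" for v
  proof -
    have "f (shift P (?g v)) = shift Q (f (?g v))"
      using assms(2) g[OF v] unfolding covering_equivalence_def by blast
    then show ?thesis using fg[OF v] gf[OF shift_points[OF assms(1) g[OF v]]] by simp
  qed
  moreover have "proj P (?g v) = proj Q v" if v: "v \<in> points Q" for v
  proof -
    have "proj Q (f (?g v)) = proj P (?g v)"
      using assms(2) g[OF v] unfolding covering_equivalence_def by blast
    then show ?thesis using fg[OF v] by simp
  qed
  moreover have "(v, w) \<in> leq Q \<longleftrightarrow> (?g v, ?g w) \<in> leq P"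
    if v: "v \<in> points Q" and w: "w \<in> points Q" for v w
  proof -
    have "(?g v, ?g w) \<in> leq P \<longleftrightarrow> (f (?g v), f (?g w)) \<in> leq Q"
      using assms(2) g[OF v] g[OF w] unfolding covering_equivalence_def poset_iso_def by blast
    then show ?thesis using fg[OF v] fg[OF w] by simp
  qed
  ultimately show ?thesis
    using bij' unfolding covering_equivalence_def poset_iso_def by blast
qed

lemma covering_equivalence_trans:
  assumes "covering_equivalence P Q f" "covering_equivalence Q R g"
  shows "covering_equivalence P R (g \<circ> f)"
proof -
  have "bij_betw f (points P) (points Q)" "bij_betw g (points Q) (points R)"
    using assms by (auto simp: covering_equivalence_def poset_iso_def)
  then show ?thesis
    using assms bij_betw_trans[of f "points P" "points Q" g "points R"]
    by (auto simp: covering_equivalence_def poset_iso_def bij_betwE)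
qed

lemma equiv_covering_equiv:
  fixes X :: "'a set"
  shows "equiv (covering_posets X) (covering_equiv X :: ('b, 'a) poset_over rel)"
proof (rule equivI)
  show "(covering_equiv X :: ('b, 'a) poset_over rel) \<subseteq> covering_posets X \<times> covering_posets X"
    by (auto simp: covering_equiv_def)
  have "covering_equivalence P P id" for P :: "('b, 'a) poset_over"
    by (auto simp: covering_equivalence_def poset_iso_def)
  then show "refl_on (covering_posets X) (covering_equiv X :: ('b, 'a) poset_over rel)"
    by (auto simp: refl_on_def covering_equiv_def)
  show "sym (covering_equiv X :: ('b, 'a) poset_over rel)"
    by (auto simp: sym_def covering_equiv_def covering_posets_def intro: covering_equivalence_sym)
  show "trans (covering_equiv X :: ('b, 'a) poset_over rel)"
    by (auto simp: trans_def covering_equiv_def intro: covering_equivalence_trans)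
qed

end

theory Submission imports Defs begin

text \<open>
  A section \<open>s\<close> of a covering poset identifies it with \<open>X \<times> \<int>\<close>, where
  \<open>(x, i) \<le> (y, j)\<close> iff \<open>b x y \<le> j - i\<close> for the offset \<open>b\<close> of \<open>s\<close>. So a covering poset
  with a section is the same as an integer function \<open>b\<close> on \<open>X \<times> X\<close> that vanishes on the
  diagonal and satisfies the triangle inequality, and translating the section by \<open>k\<close> changes
  \<open>b\<close> to \<open>b x y + k x - k y\<close>. The structure cocycle is the coboundary of \<open>b\<close>; its
  nonnegativity is the triangle inequality. Fix a base point \<open>p\<close>. Every covering poset has a
  section with \<open>b p x = 0\<close> for all \<open>x\<close>, and then \<open>b x y = c (p, x, y)\<close>; hence \<open>c\<close>
  determines the covering poset, and for any reduced cocycle \<open>c\<close> this formula defines one.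
\<close>

section \<open>Powers of the shift\<close>

text \<open>Negative powers are iterates of \<open>inv_into\<close>. Along an integer-indexed
  sequence that \<open>shift P\<close> advances, injectivity makes each of these a step back. This
  applies to fibres, to images of orbits under an equivalence, and to the poset constructed at the
  end.\<close>

lemma shift_power_along:
  assumes inj: "inj_on (shift P) (points P)"
    and g: "\<And>i :: int. g i \<in> points P" "\<And>i. shift P (g i) = g (i + 1)"
  shows "shift_power P m (g i) = g (i + m)"
proof -
  have pos: "(shift P ^^ n) (g i) = g (i + int n)" for n i
    by (induction n) (simp_all add: g algebra_simps)
  have inv: "inv_into (points P) (shift P) (g i) = g (i - 1)" for i
    using inv_into_f_f[OF inj, of "g (i - 1)"] g by simp
  have neg: "(inv_into (points P) (shift P) ^^ n) (g i) = g (i - int n)" for n i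
    by (induction n) (simp_all add: inv algebra_simps)
  show ?thesis
    by (simp add: shift_power_def pos neg)
qed

lemma shift_power_0 [simp]: "shift_power P 0 u = u"
  by (simp add: shift_power_def)

lemma shift_power_1 [simp]: "shift_power P 1 u = shift P u"
  by (simp add: shift_power_def)

text \<open>An offset is accessible through the integers above it, so equations between offsets are
  proved by comparing upper bounds.\<close>

lemma eq_if_same_upper_bounds:
  fixes a b :: "'a::order"
  assumes "\<And>n. a \<le> n \<longleftrightarrow> b \<le> n"
  shows "a = b"
  using assms[of a] assms[of b] by (simp add: antisym)

section \<open>Fibres and the action of the integers by shift powers\<close>

locale covering =
  fixes X :: "'a set" and P :: "('b, 'a) poset_over"
  assumes covering: "covering_poset X P"
begin

abbreviation T where "T \<equiv> shift_power P"

lemma leq_trans: "(u, v) \<in> leq P \<Longrightarrow> (v, w) \<in> leq P \<Longrightarrow> (u, w) \<in> leq P"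
  using covering by (auto simp: covering_poset_def preorder_on_def dest: transD)

lemma proj_in: "u \<in> points P \<Longrightarrow> proj P u \<in> X"
  using covering by (auto simp: covering_poset_def)

lemma shift_iso: "poset_iso (points P) (leq P) (points P) (leq P) (shift P)"
  using shift_automorphism_shift[OF covering] by (simp add: shift_automorphism_def)

lemma inj_shift: "inj_on (shift P) (points P)"
  using shift_iso by (auto simp: poset_iso_def bij_betw_def)

text \<open>The inverse of the isomorphism given by the fibre axiom parametrises the fibre by the
  integers. The shift gives the least strictly larger element, which is the successor in these
  coordinates.\<close>

lemma fiber_coordinate:
  assumes "x \<in> X"
  obtains g :: "int \<Rightarrow> 'b" where "bij_betw g UNIV (fiber P x)"
    "\<And>i j. (g i, g j) \<in> leq P \<longleftrightarrow> i \<le> j" "\<And>m i. T m (g i) = g (i + m)"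
proof -
  obtain f where f: "poset_iso (fiber P x) (leq P) (UNIV :: int set) {(i, j). i \<le> j} f"
    using covering assms unfolding covering_poset_def by blast
  define g where "g = inv_into (fiber P x) f"
  have bf: "bij_betw f (fiber P x) UNIV" using f by (simp add: poset_iso_def)
  then have bg: "bij_betw g UNIV (fiber P x)" by (simp add: g_def bij_betw_inv_into)
  have gin: "g i \<in> fiber P x" for i using bg by (auto simp: bij_betw_def)
  have fg: "f (g i) = i" for i using bij_betw_inv_into_right[OF bf] by (simp add: g_def)
  have gf: "g (f u) = u" if "u \<in> fiber P x" for u
    using bij_betw_inv_into_left[OF bf that] by (simp add: g_def)
  have le: "(g i, g j) \<in> leq P \<longleftrightarrow> i \<le> j" for i j
    using f gin[of i] gin[of j] by (simp add: poset_iso_def fg)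
  have step: "shift P (g i) = g (i + 1)" for i
  proof -
    have S: "shift P (g i) \<in> fiber P x" "strictly_below (leq P) (g i) (shift P (g i))"
      "\<And>v. v \<in> fiber P x \<Longrightarrow> strictly_below (leq P) (g i) v \<Longrightarrow> (shift P (g i), v) \<in> leq P"
      using shift_automorphism_shift[OF covering] gin[of i]
      by (auto simp: shift_automorphism_def fiber_def)
    define j where "j = f (shift P (g i))"
    have j: "shift P (g i) = g j" using gf[OF S(1)] by (simp add: j_def)
    have "i < j" using S(2) by (simp add: j strictly_below_def le)
    \<comment> \<open>Minimality of the shift is tested against \<open>g (i + 1)\<close>.\<close>
    moreover have "j \<le> i + 1"
      using S(3)[OF gin[of "i + 1"]] by (simp add: j strictly_below_def le)
    ultimately have "j = i + 1" by simp
    then show ?thesis using j by simp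
  qed
  have "T m (g i) = g (i + m)" for m i
    by (rule shift_power_along[OF inj_shift]) (use gin step in \<open>auto simp: fiber_def\<close>)
  with bg le show thesis by (rule that)
qed

text \<open>This turns statements about the shift powers of a single point into integer arithmetic
  on exponents.\<close>

lemma point_coordinate:
  assumes "u \<in> points P"
  obtains g :: "int \<Rightarrow> 'b" and k where "bij_betw g UNIV (fiber P (proj P u))"
    "\<And>i j. (g i, g j) \<in> leq P \<longleftrightarrow> i \<le> j" "\<And>m i. T m (g i) = g (i + m)" "u = g k"
proof -
  obtain g :: "int \<Rightarrow> 'b" where g: "bij_betw g UNIV (fiber P (proj P u))"
    "\<And>i j. (g i, g j) \<in> leq P \<longleftrightarrow> i \<le> j" "\<And>m i. T m (g i) = g (i + m)"
    using fiber_coordinate[OF proj_in[OF assms]] by blast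
  have "u \<in> range g" using g(1) assms by (auto simp: bij_betw_def fiber_def)
  then obtain k where "u = g k" by blast
  with g show thesis by (rule that)
qed

lemma T_fiber:
  assumes "u \<in> points P"
  shows "T m u \<in> points P" "proj P (T m u) = proj P u"
proof -
  have "T m u \<in> fiber P (proj P u)"
    using assms by (elim point_coordinate) (auto simp: bij_betw_def)
  then show "T m u \<in> points P" "proj P (T m u) = proj P u" by (auto simp: fiber_def)
qed

lemma T_T: "u \<in> points P \<Longrightarrow> T m (T n u) = T (n + m) u"
  by (elim point_coordinate) (simp add: algebra_simps)

lemma T_leq_T: "u \<in> points P \<Longrightarrow> (T m u, T n u) \<in> leq P \<longleftrightarrow> m \<le> n"
  by (elim point_coordinate) simp

lemma T_inj: "u \<in> points P \<Longrightarrow> T m u = T n u \<longleftrightarrow> m = n"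
  by (elim point_coordinate) (auto simp: bij_betw_def inj_eq)

lemma fiber_orbit:
  assumes "u \<in> points P" "v \<in> points P" "proj P u = proj P v"
  obtains m where "v = T m u"
proof -
  obtain g :: "int \<Rightarrow> 'b" and k where g: "bij_betw g UNIV (fiber P (proj P u))"
    "\<And>m i. T m (g i) = g (i + m)" "u = g k"
    using point_coordinate[OF assms(1)] by blast
  have "v \<in> range g" using g(1) assms by (auto simp: bij_betw_def fiber_def)
  then obtain l where "v = g l" by blast
  then have "v = T (l - k) u" using g by simp
  then show thesis by (rule that)
qed

lemma leq_shift_iff:
  "u \<in> points P \<Longrightarrow> v \<in> points P \<Longrightarrow> (shift P u, shift P v) \<in> leq P \<longleftrightarrow> (u, v) \<in> leq P"
  using shift_iso by (simp add: poset_iso_def)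

lemma leq_T_iff:
  assumes "u \<in> points P" "v \<in> points P"
  shows "(T m u, T m v) \<in> leq P \<longleftrightarrow> (u, v) \<in> leq P"
proof -
  \<comment> \<open>Since \<open>shift P\<close> preserves and reflects the order, this is an
    equivalence for every integer \<open>m\<close> and drives the induction both upward and downward
    from 0.\<close>
  have step: "(T (m + 1) u, T (m + 1) v) \<in> leq P \<longleftrightarrow> (T m u, T m v) \<in> leq P" for m
    using leq_shift_iff[OF T_fiber(1)[OF assms(1)] T_fiber(1)[OF assms(2)], of m m]
      T_T[OF assms(1), of 1 m] T_T[OF assms(2), of 1 m] by simp
  show ?thesis
  proof (induction m rule: int_induct[where k = 0])
    case (step2 i)
    then show ?case using step[of "i - 1"] by simp
  qed (simp_all add: step)
qed

lemma leq_some_T: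
  assumes "u \<in> points P" "v \<in> points P"
  obtains m where "(u, T m v) \<in> leq P"
  using covering assms unfolding covering_poset_def by blast

section \<open>The offsets of a section\<close>

text \<open>The exponents \<open>m\<close> with \<open>s x\<close> below \<open>T m (s y)\<close>
  form an up-set, nonempty by the last axiom of a covering poset. The same axiom with
  \<open>x\<close> and \<open>y\<close> exchanged gives \<open>k\<close>; composing puts
  \<open>s x\<close> below \<open>T (k + m) (s x)\<close>, so \<open>- k\<close> is a lower bound
  and a minimum exists.\<close>

lemma offset_le_iff:
  assumes s: "is_section X P s" and x: "x \<in> X" and y: "y \<in> X"
  shows "section_offset P s x y \<le> m \<longleftrightarrow> (s x, T m (s y)) \<in> leq P"
proof -
  have sx: "s x \<in> points P" and sy: "s y \<in> points P"
    using s x y by (auto simp: is_section_def)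
  let ?M = "\<lambda>m. (s x, T m (s y)) \<in> leq P"
  have up: "?M n" if "?M m" "m \<le> n" for m n
    using leq_trans[OF that(1)] T_leq_T[OF sy] that(2) by blast
  obtain m0 where m0: "?M m0" using leq_some_T[OF sx sy] by blast
  obtain k where k: "(s y, T k (s x)) \<in> leq P" using leq_some_T[OF sy sx] by blast
  have bound: "- k \<le> m" if "?M m" for m
  proof -
    have "(T m (s y), T m (T k (s x))) \<in> leq P"
      using k leq_T_iff[OF sy T_fiber(1)[OF sx]] by blast
    with that have "(T 0 (s x), T (k + m) (s x)) \<in> leq P"
      by (simp add: T_T[OF sx] leq_trans)
    then show ?thesis using T_leq_T[OF sx, of 0 "k + m"] by simp
  qed
  \<comment> \<open>The integers are not well-ordered, so the minimum is first taken over the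
    naturals, after translating exponents by the bound \<open>k\<close>.\<close>
  define n where "n = (LEAST n. ?M (int n - k))"
  have "?M (int (nat (m0 + k)) - k)" using m0 bound[OF m0] by simp
  then have n: "?M (int n - k)" unfolding n_def by (rule LeastI)
  have least: "int n - k \<le> m" if "?M m" for m
  proof -
    have "?M (int (nat (m + k)) - k)" using that bound[OF that] by simp
    then have "n \<le> nat (m + k)" unfolding n_def by (rule Least_le)
    then show ?thesis using bound[OF that] by linarith
  qed
  have "section_offset P s x y = int n - k"
    unfolding section_offset_def by (rule Least_equality) (use n least in auto)
  then show ?thesis using least up[OF n] by auto
qed

text \<open>With \<open>(x, i)\<close> as coordinates of the point \<open>T i (s x)\<close>, the
  offsets encode the whole order.\<close>

lemma leq_coordinate_iff:
  assumes s: "is_section X P s" and x: "x \<in> X" and y: "y \<in> X"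
  shows "(T i (s x), T j (s y)) \<in> leq P \<longleftrightarrow> section_offset P s x y \<le> j - i"
proof -
  have sx: "s x \<in> points P" and sy: "s y \<in> points P"
    using s x y by (auto simp: is_section_def)
  have "(T i (s x), T j (s y)) \<in> leq P \<longleftrightarrow> (T i (s x), T i (T (j - i) (s y))) \<in> leq P"
    using T_T[OF sy] by simp
  also have "\<dots> \<longleftrightarrow> (s x, T (j - i) (s y)) \<in> leq P"
    by (rule leq_T_iff[OF sx T_fiber(1)[OF sy]])
  finally show ?thesis using offset_le_iff[OF assms] by simp
qed

lemma offset_refl:
  assumes s: "is_section X P s" and x: "x \<in> X"
  shows "section_offset P s x x = 0"
proof (rule eq_if_same_upper_bounds)
  have "s x \<in> points P" using s x by (auto simp: is_section_def)
  then show "section_offset P s x x \<le> n \<longleftrightarrow> 0 \<le> n" for n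
    using T_leq_T[of "s x" 0 n] by (simp add: offset_le_iff[OF s x x])
qed

text \<open>Transitivity through \<open>T ?b (s y)\<close>, the lowest point over \<open>y\<close>
  that lies above \<open>s x\<close>.\<close>

lemma offset_triangle:
  assumes s: "is_section X P s" and x: "x \<in> X" and y: "y \<in> X" and z: "z \<in> X"
  shows "section_offset P s x z \<le> section_offset P s x y + section_offset P s y z"
proof -
  let ?b = "section_offset P s x y" and ?d = "section_offset P s y z"
  have "(T 0 (s x), T ?b (s y)) \<in> leq P"
    using leq_coordinate_iff[OF s x y, of 0 ?b] by simp
  moreover have "(T ?b (s y), T (?b + ?d) (s z)) \<in> leq P"
    using leq_coordinate_iff[OF s y z, of ?b "?b + ?d"] by simp
  ultimately have "(T 0 (s x), T (?b + ?d) (s z)) \<in> leq P" by (rule leq_trans)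
  then show ?thesis using leq_coordinate_iff[OF s x z, of 0 "?b + ?d"] by simp
qed

lemma section_translate:
  assumes "is_section X P s"
  shows "is_section X P (\<lambda>x. T (k x) (s x))"
  using assms by (simp add: is_section_def T_fiber)

text \<open>Translating both ends replaces the exponent \<open>n\<close> in the defining inequality
  by \<open>k y + n - k x\<close>.\<close>

lemma offset_translate:
  assumes s: "is_section X P s" and t: "\<And>x. x \<in> X \<Longrightarrow> t x = T (k x) (s x)"
    and x: "x \<in> X" and y: "y \<in> X"
  shows "section_offset P t x y = section_offset P s x y + k x - k y"
proof (rule eq_if_same_upper_bounds)
  fix n
  have sy: "s y \<in> points P" using s y by (auto simp: is_section_def)
  have st: "is_section X P t" using section_translate[OF s, of k] t by (simp add: is_section_def)
  have "section_offset P t x y \<le> n \<longleftrightarrow> (T (k x) (s x), T (k y + n) (s y)) \<in> leq P"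
    by (simp add: offset_le_iff[OF st x y] t x y T_T[OF sy])
  then show "section_offset P t x y \<le> n \<longleftrightarrow> section_offset P s x y + k x - k y \<le> n"
    using leq_coordinate_iff[OF s x y] by auto
qed

section \<open>Sections and the structure cocycle\<close>

lemma section_exists: obtains s where "is_section X P s"
proof -
  have "\<forall>x\<in>X. \<exists>u. u \<in> points P \<and> proj P u = x"
    using covering by (auto simp: covering_poset_def)
  then obtain s where "\<forall>x\<in>X. s x \<in> points P \<and> proj P (s x) = x" by metis
  then show thesis using that[of s] by (simp add: is_section_def)
qed

lemma sections_differ_by_translation:
  assumes s: "is_section X P s" and t: "is_section X P t"
  obtains k where "\<And>x. x \<in> X \<Longrightarrow> t x = T (k x) (s x)"
proof -
  have "\<forall>x\<in>X. \<exists>m. t x = T m (s x)"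
    using s t unfolding is_section_def by (metis fiber_orbit)
  then show thesis using that by metis
qed

text \<open>One section suffices: any other is a translate by some \<open>k\<close>, and the
  corrections \<open>k y - k z\<close>, \<open>- (k x - k z)\<close> and \<open>k x - k y\<close>
  add up to zero.\<close>

lemma is_structure_cocycleI:
  assumes c: "c \<in> X \<times> X \<times> X \<rightarrow>\<^sub>E UNIV" and s: "is_section X P s"
    and eq: "\<And>x y z. x \<in> X \<Longrightarrow> y \<in> X \<Longrightarrow> z \<in> X \<Longrightarrow> int (c (x, y, z)) =
      section_offset P s y z - section_offset P s x z + section_offset P s x y"
  shows "is_structure_cocycle X P c"
  unfolding is_structure_cocycle_def
proof (intro conjI c allI impI ballI)
  fix t x y z assume t: "is_section X P t" and xyz: "x \<in> X" "y \<in> X" "z \<in> X"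
  obtain k where k: "\<And>x. x \<in> X \<Longrightarrow> t x = T (k x) (s x)"
    using sections_differ_by_translation[OF s t] by blast
  show "int (c (x, y, z)) =
      section_offset P t y z - section_offset P t x z + section_offset P t x y"
    by (simp add: eq xyz offset_translate[OF s k])
qed

text \<open>The cocycle identity holds because \<open>c\<close> is a coboundary, reducedness because
  offsets vanish on the diagonal.\<close>

lemma structure_cocycle_exists:
  obtains c where "c \<in> reduced_cocycles X" "is_structure_cocycle X P c"
proof -
  obtain s where s: "is_section X P s" by (rule section_exists)
  let ?b = "section_offset P s"
  \<comment> \<open>By the triangle inequality \<open>nat\<close> truncates nothing here.\<close>
  define c where "c = (\<lambda>(x, y, z) \<in> X \<times> X \<times> X. nat (?b y z - ?b x z + ?b x y))"
  have c: "c \<in> X \<times> X \<times> X \<rightarrow>\<^sub>E UNIV" by (simp add: c_def)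
  have eq: "int (c (x, y, z)) = ?b y z - ?b x z + ?b x y"
    if "x \<in> X" "y \<in> X" "z \<in> X" for x y z
    using offset_triangle[OF s that] that by (simp add: c_def)
  have "cocycle X c" by (simp add: cocycle_def eq)
  moreover have "c (x, x, y) = 0" "c (x, y, y) = 0" if "x \<in> X" "y \<in> X" for x y
    using eq[of x x y] eq[of x y y] that by (simp_all add: offset_refl[OF s])
  ultimately have "c \<in> reduced_cocycles X" using c by (simp add: reduced_cocycles_def)
  then show thesis using that is_structure_cocycleI[OF c s eq] by blast
qed

text \<open>The formula in \<open>is_structure_cocycle\<close> fixes the values on triples from
  \<open>X\<close> because a section exists; extensionality fixes the others.\<close>

lemma structure_cocycle_unique:
  assumes "is_structure_cocycle X P c" "is_structure_cocycle X P d"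
  shows "c = d"
proof -
  obtain s where s: "is_section X P s" by (rule section_exists)
  have "int (c (x, y, z)) = int (d (x, y, z))" if "x \<in> X" "y \<in> X" "z \<in> X" for x y z
    using assms s that by (simp add: is_structure_cocycle_def)
  then show ?thesis
    using assms by (intro extensionalityI[of _ "X \<times> X \<times> X"])
      (auto simp: is_structure_cocycle_def PiE_def)
qed

lemma normalized_section:
  assumes c: "is_structure_cocycle X P c" and p: "p \<in> X"
  obtains s where "is_section X P s"
    "\<And>x y. x \<in> X \<Longrightarrow> y \<in> X \<Longrightarrow> section_offset P s x y = int (c (p, x, y))"
proof -
  obtain s where s: "is_section X P s" by (rule section_exists)
  \<comment> \<open>This translation makes the offset from \<open>p\<close> to \<open>x\<close>
    equal to \<open>b p x + b p p - b p x = 0\<close>, where \<open>b\<close> is the offset of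
    \<open>s\<close>. In the formula for \<open>c (p, x, y)\<close> only the offset from
    \<open>x\<close> to \<open>y\<close> then survives.\<close>
  define t where "t x = T (section_offset P s p x) (s x)" for x
  have t: "is_section X P t" unfolding t_def by (rule section_translate[OF s])
  have "section_offset P t p x = 0" if "x \<in> X" for x
    by (simp add: offset_translate[OF s t_def p that] offset_refl[OF s p])
  then have "section_offset P t x y = int (c (p, x, y))" if "x \<in> X" "y \<in> X" for x y
    using c t p that by (simp add: is_structure_cocycle_def)
  with t show thesis by (rule that)
qed

text \<open>\<open>proj\<close> recovers \<open>x\<close>, and then \<open>i\<close> is determined
  because distinct shift powers of a point differ. Every point lies in the orbit of the value of
  \<open>s\<close> at its projection.\<close>

lemma coordinates_bij:
  assumes s: "is_section X P s"
  shows "bij_betw (\<lambda>(x, i). T i (s x)) (X \<times> UNIV) (points P)"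
proof -
  have sp: "s x \<in> points P" "proj P (s x) = x" if "x \<in> X" for x
    using s that by (auto simp: is_section_def)
  have "inj_on (\<lambda>(x, i). T i (s x)) (X \<times> UNIV)"
  proof (rule inj_onI, clarify)
    fix x i y j assume xy: "x \<in> X" "y \<in> X" and eq: "T i (s x) = T j (s y)"
    then have "proj P (T i (s x)) = proj P (T j (s y))" by simp
    then have "x = y" using xy by (simp add: T_fiber sp)
    then show "x = y \<and> i = j" using eq T_inj[OF sp(1)] xy by simp
  qed
  moreover have "\<exists>x\<in>X. \<exists>i. u = T i (s x)" if u: "u \<in> points P" for u
    using fiber_orbit[OF sp(1)[OF proj_in[OF u]] u] sp(2) proj_in[OF u] by metis
  ultimately show ?thesis by (force simp: bij_betw_def T_fiber sp)
qed

end

section \<open>Equivalence of covering posets and equality of cocycles\<close>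

text \<open>Points with the same coordinates \<open>(x, i)\<close> are matched: the offsets
  determine the order, and both shifts raise \<open>i\<close> by one.\<close>

lemma covering_equivalence_if_same_offsets:
  assumes P: "covering_poset X P" and Q: "covering_poset X Q"
    and s: "is_section X P s" and t: "is_section X Q t"
    and eq: "\<And>x y. x \<in> X \<Longrightarrow> y \<in> X \<Longrightarrow> section_offset P s x y = section_offset Q t x y"
  shows "\<exists>f. covering_equivalence P Q f"
proof -
  interpret P: covering X P by unfold_locales (rule P)
  interpret Q: covering X Q by unfold_locales (rule Q)
  let ?\<kappa> = "\<lambda>(x, i). P.T i (s x)" and ?\<mu> = "\<lambda>(x, i). Q.T i (t x)"
  let ?D = "X \<times> (UNIV :: int set)"
  define f where "f = ?\<mu> \<circ> inv_into ?D ?\<kappa>"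
  have bk: "bij_betw ?\<kappa> ?D (points P)" by (rule P.coordinates_bij[OF s])
  have bf: "bij_betw f (points P) (points Q)"
    unfolding f_def by (rule bij_betw_trans[OF bij_betw_inv_into[OF bk] Q.coordinates_bij[OF t]])
  have f: "f (P.T i (s x)) = Q.T i (t x)" if "x \<in> X" for x i
    using bij_betw_inv_into_left[OF bk, of "(x, i)"] that by (simp add: f_def)
  have coord: "\<exists>x\<in>X. \<exists>i. u = P.T i (s x)" if "u \<in> points P" for u
    using bij_betw_imp_surj_on[OF bk] that by force
  have sp: "s x \<in> points P" "proj P (s x) = x" "t x \<in> points Q" "proj Q (t x) = x" if "x \<in> X" for x
    using s t that by (auto simp: is_section_def)
  have "(u, v) \<in> leq P \<longleftrightarrow> (f u, f v) \<in> leq Q" if u: "u \<in> points P" and v: "v \<in> points P" for u v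
  proof -
    obtain x i y j where xy: "x \<in> X" "y \<in> X" and uv: "u = P.T i (s x)" "v = P.T j (s y)"
      using coord[OF u] coord[OF v] by blast
    show ?thesis
      by (simp add: uv f xy P.leq_coordinate_iff[OF s xy] Q.leq_coordinate_iff[OF t xy] eq)
  qed
  moreover have "proj Q (f u) = proj P u \<and> f (shift P u) = shift Q (f u)"
    if u: "u \<in> points P" for u
  proof -
    obtain x i where x: "x \<in> X" and u: "u = P.T i (s x)" using coord[OF u] by blast
    have "shift P u = P.T (i + 1) (s x)" "shift Q (f u) = Q.T (i + 1) (t x)"
      using P.T_T[OF sp(1)[OF x], of 1 i] Q.T_T[OF sp(3)[OF x], of 1 i] by (simp_all add: u f x)
    then show ?thesis by (simp add: u f x P.T_fiber Q.T_fiber sp)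
  qed
  ultimately show ?thesis using bf by (auto simp: covering_equivalence_def poset_iso_def)
qed

lemma covering_equivalence_if_same_cocycle:
  assumes P: "covering_poset X P" "is_structure_cocycle X P c"
    and Q: "covering_poset X Q" "is_structure_cocycle X Q c"
  shows "\<exists>f. covering_equivalence P Q f"
proof -
  interpret P: covering X P by unfold_locales (rule P)
  interpret Q: covering X Q by unfold_locales (rule Q)
  obtain s t where "is_section X P s" "is_section X Q t"
    "\<And>x y. x \<in> X \<Longrightarrow> y \<in> X \<Longrightarrow> section_offset P s x y = section_offset Q t x y"
  \<comment> \<open>Without a base point, all functions are vacuously sections. Otherwise
    normalising at the same \<open>p\<close> in both posets makes both offsets
    \<open>c (p, x, y)\<close>.\<close>
  proof (cases "X = {}")
    case True
    then show thesis using that by (simp add: is_section_def)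
  next
    case False
    then obtain p where p: "p \<in> X" by blast
    then show thesis
      using P.normalized_section[OF P(2) p] Q.normalized_section[OF Q(2) p] that by metis
  qed
  with P Q show ?thesis by (intro covering_equivalence_if_same_offsets)
qed

text \<open>The definition of an equivalence gives commutation with \<open>shift\<close> only.
  Negative powers are covered as well because \<open>shift Q\<close> advances the sequence
  \<open>f (P.T i u)\<close>.\<close>

lemma shift_power_equivariant:
  assumes P: "covering_poset X P" and Q: "covering_poset X Q"
    and f: "covering_equivalence P Q f" and u: "u \<in> points P"
  shows "f (shift_power P m u) = shift_power Q m (f u)"
proof -
  interpret P: covering X P by unfold_locales (rule P)
  interpret Q: covering X Q by unfold_locales (rule Q)
  have "f v \<in> points Q" if "v \<in> points P" for v
    using f that by (auto simp: covering_equivalence_def poset_iso_def bij_betwE)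
  moreover have "shift Q (f v) = f (shift P v)" if "v \<in> points P" for v
    using f that by (simp add: covering_equivalence_def)
  moreover have "shift P (P.T i u) = P.T (i + 1) u" for i
    using P.T_T[OF u, of 1 i] by simp
  ultimately have "shift_power Q m (f (P.T 0 u)) = f (P.T (0 + m) u)"
    by (intro shift_power_along[OF Q.inj_shift, where g = "\<lambda>i. f (P.T i u)"])
      (simp_all add: P.T_fiber u)
  then show ?thesis by simp
qed

text \<open>The image \<open>f \<circ> s\<close> of a section satisfies the same inequalities as
  \<open>s\<close> and so has the same offsets; checking this one section of \<open>Q\<close> is
  enough.\<close>

lemma structure_cocycle_invariant:
  assumes P: "covering_poset X P" and Q: "covering_poset X Q"
    and f: "covering_equivalence P Q f" and c: "is_structure_cocycle X P c"
  shows "is_structure_cocycle X Q c"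
proof -
  interpret P: covering X P by unfold_locales (rule P)
  interpret Q: covering X Q by unfold_locales (rule Q)
  obtain s where s: "is_section X P s" by (rule P.section_exists)
  have fs: "f u \<in> points Q \<and> proj Q (f u) = proj P u" if "u \<in> points P" for u
    using f that by (auto simp: covering_equivalence_def poset_iso_def bij_betwE)
  have sp: "s x \<in> points P" "proj P (s x) = x" if "x \<in> X" for x
    using s that by (auto simp: is_section_def)
  have "section_offset Q (f \<circ> s) x y = section_offset P s x y" if xy: "x \<in> X" "y \<in> X" for x y
  proof -
    have "(f (s x), shift_power Q m (f (s y))) \<in> leq Q \<longleftrightarrow> (s x, P.T m (s y)) \<in> leq P" for m
    proof -
      have "(s x, P.T m (s y)) \<in> leq P \<longleftrightarrow> (f (s x), f (P.T m (s y))) \<in> leq Q"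
        using f sp(1)[OF xy(1)] P.T_fiber(1)[OF sp(1)[OF xy(2)]]
        by (simp add: covering_equivalence_def poset_iso_def)
      then show ?thesis by (simp add: shift_power_equivariant[OF P Q f sp(1)[OF xy(2)]])
    qed
    then show ?thesis by (simp add: section_offset_def)
  qed
  moreover have "is_section X Q (f \<circ> s)" by (simp add: is_section_def fs sp)
  ultimately show ?thesis
    using c s by (intro Q.is_structure_cocycleI[of c "f \<circ> s"]) (simp_all add: is_structure_cocycle_def)
qed

section \<open>Covering posets with prescribed offsets\<close>

text \<open>
  The embedding \<open>e\<close> only serves to realise the poset \<open>X \<times> \<int>\<close> on the prescribed point type.
\<close>

definition offset_poset ::
    "('a \<times> int \<Rightarrow> 'b) \<Rightarrow> 'a set \<Rightarrow> ('a \<Rightarrow> 'a \<Rightarrow> int) \<Rightarrow> ('b, 'a) poset_over" where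
  "offset_poset e X b =
     \<lparr>points = e ` (X \<times> UNIV),
      leq = {(e (x, i), e (y, j)) | x i y j. x \<in> X \<and> y \<in> X \<and> b x y \<le> j - i},
      proj = fst \<circ> inv_into (X \<times> UNIV) e\<rparr>"

text \<open>The zero diagonal gives reflexivity and the usual integer order on each fibre, the
  triangle inequality gives transitivity, and the shift adds one to the integer coordinate.\<close>

lemma covering_offset_poset:
  fixes e :: "'a \<times> int \<Rightarrow> 'b"
  assumes e: "inj_on e (X \<times> UNIV)"
    and b0: "\<And>x. x \<in> X \<Longrightarrow> b x x = 0"
    and b_tri: "\<And>x y z. x \<in> X \<Longrightarrow> y \<in> X \<Longrightarrow> z \<in> X \<Longrightarrow> b x z \<le> b x y + b y z"
  shows "covering_poset X (offset_poset e X b)"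
    and "is_section X (offset_poset e X b) (\<lambda>x. e (x, 0))"
    and "x \<in> X \<Longrightarrow> y \<in> X \<Longrightarrow> section_offset (offset_poset e X b) (\<lambda>x. e (x, 0)) x y = b x y"
proof -
  let ?P = "offset_poset e X b"
  have pts: "points ?P = e ` (X \<times> UNIV)" by (simp add: offset_poset_def)
  have e_eq: "e (x, i) = e (y, j) \<longleftrightarrow> x = y \<and> i = j" if "x \<in> X" "y \<in> X" for x y i j
    using inj_on_eq_iff[OF e, of "(x, i)" "(y, j)"] that by simp
  have le: "(e (x, i), e (y, j)) \<in> leq ?P \<longleftrightarrow> b x y \<le> j - i" if "x \<in> X" "y \<in> X" for x y i j
    using that by (auto simp: offset_poset_def e_eq)
  have pr: "proj ?P (e (x, i)) = x" if "x \<in> X" for x i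
    using inv_into_f_f[OF e, of "(x, i)"] that by (simp add: offset_poset_def)
  have fib: "fiber ?P x = (\<lambda>i. e (x, i)) ` UNIV" if "x \<in> X" for x
    using that by (auto simp: fiber_def pts pr)
  have e_inv: "inv_into (X \<times> UNIV) e (e (x, i)) = (x, i)" if "x \<in> X" for x i
    using inv_into_f_f[OF e, of "(x, i)"] that by simp

  define \<sigma> where "\<sigma> = (\<lambda>u \<in> points ?P. case inv_into (X \<times> UNIV) e u of (x, i) \<Rightarrow> e (x, i + 1))"
  have \<sigma>: "\<sigma> (e (x, i)) = e (x, i + 1)" if "x \<in> X" for x i
    using that by (simp add: \<sigma>_def pts e_inv)
  have "bij_betw \<sigma> (points ?P) (points ?P)"
    by (rule bij_betw_byWitness[where f' = "\<lambda>u. case inv_into (X \<times> UNIV) e u of (x, i) \<Rightarrow> e (x, i - 1)"])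
      (auto simp: pts \<sigma> e_inv)
  then have auto: "shift_automorphism ?P \<sigma>"
    by (auto simp: shift_automorphism_def poset_iso_def pts \<sigma> le pr fib strictly_below_def b0)
  \<comment> \<open>\<open>shift_automorphism_unique\<close> presupposes a covering poset, whose
    last axiom already speaks of \<open>shift\<close>. To avoid this circle, uniqueness of the shift
    is derived from antisymmetry on fibres.\<close>
  have fiber_antisym: "u = v" if "u \<in> points ?P" "u \<in> fiber ?P z" "v \<in> fiber ?P z"
    "(u, v) \<in> leq ?P" "(v, u) \<in> leq ?P" for u v z
  proof -
    have "z \<in> X" using that(1,2) by (auto simp: fiber_def pts pr)
    then show ?thesis using that by (auto simp: fib le b0)
  qed
  have "shift ?P = \<sigma>" unfolding shift_def
  proof (rule the_equality)
    show "\<sigma> \<in> extensional (points ?P) \<and> shift_automorphism ?P \<sigma>"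
      using auto by (simp add: \<sigma>_def)
    fix \<tau> assume \<tau>: "\<tau> \<in> extensional (points ?P) \<and> shift_automorphism ?P \<tau>"
    show "\<tau> = \<sigma>"
    proof (rule extensionalityI[of _ "points ?P"])
      fix u assume u: "u \<in> points ?P"
      have \<tau>u: "\<tau> u \<in> fiber ?P (proj ?P u)" and \<sigma>u: "\<sigma> u \<in> fiber ?P (proj ?P u)"
        and le: "(\<tau> u, \<sigma> u) \<in> leq ?P" "(\<sigma> u, \<tau> u) \<in> leq ?P"
        using \<tau> auto u by (auto simp: shift_automorphism_def)
      have "\<tau> u \<in> points ?P" using \<tau>u by (simp add: fiber_def)
      then show "\<tau> u = \<sigma> u" using \<tau>u \<sigma>u le by (rule fiber_antisym)
    qed (use \<tau> in \<open>simp_all add: \<sigma>_def\<close>)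
  qed
  then have T: "shift_power ?P m (e (x, i)) = e (x, i + m)" if "x \<in> X" for x i m
    using auto that
    by (intro shift_power_along) (auto simp: \<sigma> pts shift_automorphism_def poset_iso_def bij_betw_def)

  have "preorder_on (points ?P) (leq ?P)"
    unfolding preorder_on_def
  proof (intro conjI)
    show "refl_on (points ?P) (leq ?P)" by (auto simp: refl_on_def pts le b0)
    show "leq ?P \<subseteq> points ?P \<times> points ?P" by (auto simp: offset_poset_def)
    show "trans (leq ?P)"
    proof (rule transI)
      fix u v w assume uv: "(u, v) \<in> leq ?P" and vw: "(v, w) \<in> leq ?P"
      from uv obtain x i y j where 1: "u = e (x, i)" "v = e (y, j)" "x \<in> X" "y \<in> X"
        by (auto simp: offset_poset_def)
      from vw obtain z k where 2: "w = e (z, k)" "z \<in> X" by (auto simp: offset_poset_def)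
      show "(u, w) \<in> leq ?P"
        using uv vw b_tri[OF 1(3,4) 2(2)] by (simp add: 1 2 le)
    qed
  qed
  moreover have "proj ?P ` points ?P = X" by (force simp: pts pr)
  moreover have "\<exists>f. poset_iso (fiber ?P x) (leq ?P) (UNIV :: int set) {(i, j). i \<le> j} f"
    if x: "x \<in> X" for x
  proof
    show "poset_iso (fiber ?P x) (leq ?P) UNIV {(i, j). i \<le> j} (snd \<circ> inv_into (X \<times> UNIV) e)"
      unfolding poset_iso_def
    proof (intro conjI)
      show "bij_betw (snd \<circ> inv_into (X \<times> UNIV) e) (fiber ?P x) (UNIV :: int set)"
        by (rule bij_betw_byWitness[where f' = "\<lambda>i. e (x, i)"]) (auto simp: fib x e_inv)
    qed (auto simp: fib x le b0 e_inv)
  qed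
  moreover have "\<exists>m\<ge>0. (u, shift_power ?P m v) \<in> leq ?P \<and>
      (shift_power ?P m v, shift_power ?P (2 * m) u) \<in> leq ?P"
    if "u \<in> points ?P" "v \<in> points ?P" for u v
  proof -
    obtain x i y j where 1: "x \<in> X" "y \<in> X" "u = e (x, i)" "v = e (y, j)"
      using \<open>u \<in> points ?P\<close> \<open>v \<in> points ?P\<close> by (auto simp: pts)
    show ?thesis
      \<comment> \<open>In coordinates the two inequalities read
        \<open>b x y \<le> (j + m) - i\<close> and \<open>b y x \<le> (i + 2 * m) - (j + m)\<close>;
        the witness is the least nonnegative solution \<open>m\<close>.\<close>
      by (rule exI[of _ "max 0 (max (b x y - (j - i)) (b y x + (j - i)))"])
        (simp add: 1 T le, linarith)
  qed
  ultimately show "covering_poset X ?P" using auto unfolding covering_poset_def by blast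
  show "is_section X ?P (\<lambda>x. e (x, 0))" by (simp add: is_section_def pts pr)
  show "section_offset ?P (\<lambda>x. e (x, 0)) x y = b x y" if "x \<in> X" "y \<in> X"
    unfolding section_offset_def using that by (intro Least_equality) (simp_all add: T le)
qed

text \<open>With the base point as first argument \<open>w\<close>, the cocycle identity says that
  \<open>c\<close> is the coboundary of \<open>b\<close>, so nonnegativity of \<open>c\<close> is
  the triangle inequality for \<open>b\<close>. Reducedness gives the zero diagonal.\<close>

lemma reduced_cocycle_realized:
  fixes X :: "'a set"
  assumes "X \<times> (UNIV :: int set) \<lesssim> (UNIV :: 'b set)" and c: "c \<in> reduced_cocycles X"
  obtains P :: "('b, 'a) poset_over" where "covering_poset X P" "is_structure_cocycle X P c"
proof -
  obtain e :: "'a \<times> int \<Rightarrow> 'b" where e: "inj_on e (X \<times> UNIV)"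
    using assms(1) by (auto simp: lepoll_def)
  \<comment> \<open>\<open>SOME\<close> spares a case split on empty \<open>X\<close>: membership of
    \<open>p\<close> is claimed only when some element of \<open>X\<close> is at hand.\<close>
  define p where "p = (SOME p. p \<in> X)"
  have p: "p \<in> X" if "x \<in> X" for x using someI[of "\<lambda>p. p \<in> X", OF that] by (simp add: p_def)
  define b where "b x y = int (c (p, x, y))" for x y
  have coc: "int (c (x, y, z)) = b y z - b x z + b x y" if "x \<in> X" "y \<in> X" "z \<in> X" for x y z
  proof -
    have "int (c (x, y, z)) - b y z + b x z - b x y = 0"
      using c p[OF that(1)] that unfolding reduced_cocycles_def cocycle_def b_def by blast
    then show ?thesis by simp
  qed
  have b0: "b x x = 0" if "x \<in> X" for x
    using c p[OF that] that by (simp add: reduced_cocycles_def b_def)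
  have tri: "b x z \<le> b x y + b y z" if "x \<in> X" "y \<in> X" "z \<in> X" for x y z
    using coc[OF that] by simp
  note M = covering_offset_poset[OF e, of b, OF b0 tri]
  interpret covering X "offset_poset e X b" by unfold_locales (rule M(1))
  have "is_structure_cocycle X (offset_poset e X b) c"
    by (rule is_structure_cocycleI[OF _ M(2)])
      (use c in \<open>simp_all add: reduced_cocycles_def M(3) coc\<close>)
  with M(1) show thesis by (rule that)
qed

section \<open>The bijection between classes and reduced cocycles\<close>

theorem theorem1p1p11:
  fixes X :: "'a set"
  assumes "X \<times> (UNIV :: int set) \<lesssim> (UNIV :: 'b set)"
  shows "\<exists>\<Phi> :: ('b, 'a) poset_over set \<Rightarrow> ('a \<times> 'a \<times> 'a \<Rightarrow> nat).
    bij_betw \<Phi> (covering_posets X // covering_equiv X) (reduced_cocycles X) \<and>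
    (\<forall>P\<in>covering_posets X. is_structure_cocycle X P (\<Phi> (covering_equiv X `` {P})))"
proof -
  let ?C = "covering_posets X :: ('b, 'a) poset_over set"
  let ?E = "covering_equiv X :: ('b, 'a) poset_over rel"
  \<comment> \<open>The description ranges over all representatives of the class;
    \<open>\<Phi>_eq\<close> shows, by invariance and uniqueness of the structure cocycle, that any
    single one computes it.\<close>
  define \<Phi> where "\<Phi> A = (THE c. \<exists>P\<in>A. is_structure_cocycle X P c)"
    for A :: "('b, 'a) poset_over set"
  have eqv: "equiv ?C ?E" by (rule equiv_covering_equiv)
  have cov: "covering X P" if "P \<in> ?C" for P
    using that by (simp add: covering_def covering_posets_def)
  have \<Phi>_eq: "\<Phi> (?E `` {P}) = c" if P: "P \<in> ?C" and c: "is_structure_cocycle X P c" for P c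
    unfolding \<Phi>_def
  proof (rule the_equality)
    show "\<exists>P\<in>?E `` {P}. is_structure_cocycle X P c"
      using c equiv_class_self[OF eqv P] by blast
    fix d assume "\<exists>Q\<in>?E `` {P}. is_structure_cocycle X Q d"
    then obtain Q f where Q: "Q \<in> ?C" "covering_equivalence P Q f" "is_structure_cocycle X Q d"
      by (auto simp: covering_equiv_def)
    then have "is_structure_cocycle X Q c"
      using P c structure_cocycle_invariant[of X P Q f c] by (simp add: covering_posets_def)
    then show "d = c"
      using covering.structure_cocycle_unique[OF cov[OF Q(1)] Q(3)] by blast
  qed
  have \<Phi>: "\<Phi> (?E `` {P}) \<in> reduced_cocycles X" "is_structure_cocycle X P (\<Phi> (?E `` {P}))"
    if P: "P \<in> ?C" for P
  proof -
    obtain c where c: "c \<in> reduced_cocycles X" "is_structure_cocycle X P c"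
      by (rule covering.structure_cocycle_exists[OF cov[OF P]])
    then show "\<Phi> (?E `` {P}) \<in> reduced_cocycles X" "is_structure_cocycle X P (\<Phi> (?E `` {P}))"
      by (simp_all only: \<Phi>_eq[OF P c(2)])
  qed
  have "bij_betw \<Phi> (?C // ?E) (reduced_cocycles X)"
    unfolding bij_betw_def
  proof (intro conjI inj_onI)
    fix A B assume "A \<in> ?C // ?E" "B \<in> ?C // ?E" and eq: "\<Phi> A = \<Phi> B"
    then obtain P Q where PQ: "P \<in> ?C" "Q \<in> ?C" "A = ?E `` {P}" "B = ?E `` {Q}"
      by (metis quotientE)
    have "is_structure_cocycle X P (\<Phi> A)" "is_structure_cocycle X Q (\<Phi> A)"
      using \<Phi>(2)[OF PQ(1)] \<Phi>(2)[OF PQ(2)] by (simp_all only: flip: PQ(3,4) eq)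
    moreover have "covering_poset X P" "covering_poset X Q"
      using PQ(1,2) by (simp_all add: covering_posets_def)
    ultimately have "\<exists>f. covering_equivalence P Q f"
      by (intro covering_equivalence_if_same_cocycle[of X P "\<Phi> A" Q])
    then have "(P, Q) \<in> ?E" using PQ(1,2) by (simp add: covering_equiv_def)
    then show "A = B" using equiv_class_eq[OF eqv] PQ(3,4) by simp
  next
    show "\<Phi> ` (?C // ?E) = reduced_cocycles X"
    proof (intro equalityI subsetI)
      fix c assume c: "c \<in> reduced_cocycles X"
      \<comment> \<open>Surjectivity is where the room for \<open>X \<times> UNIV\<close> in the
        point type enters.\<close>
      obtain P :: "('b, 'a) poset_over" where P: "covering_poset X P" "is_structure_cocycle X P c"
        by (rule reduced_cocycle_realized[OF assms c])
      then have "P \<in> ?C" by (simp add: covering_posets_def)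
      then have "\<Phi> (?E `` {P}) = c" "?E `` {P} \<in> ?C // ?E"
        by (rule \<Phi>_eq[OF _ P(2)], rule quotientI)
      then show "c \<in> \<Phi> ` (?C // ?E)" by blast
    next
      fix c assume "c \<in> \<Phi> ` (?C // ?E)"
      then obtain A where A: "A \<in> ?C // ?E" "c = \<Phi> A" by blast
      then show "c \<in> reduced_cocycles X" by (metis quotientE \<Phi>(1))
    qed
  qed
  then show ?thesis using \<Phi>(2) by (intro exI[of _ \<Phi>]) simp
qed

end
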